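(* Let $\mathcal{B}$ be an interval building set on $[n]$, and define $\mathcal{B}'=\mathcal{B}\cup\{\{n+1\},\{n,n+1\},\{n-1,n,n+1\},\dots,[n+1]\}$. Then $\mathcal{B}'$ is a building set on $[n+1]$ and the extended nested complex $\mathcal{N}^{\square}(\mathcal{B})$ is isomorphic (as a simplicial complex) to the nested complex $\mathcal{N}(\mathcal{B}')$.
   Context: A building set on a finite set $X$ is a collection $\mathcal{B}$ of nonempty subsets of $X$ containing all singletons and such that $I\cup J\in\mathcal{B}$ whenever $I,J\in\mathcal{B}$, $I\cap J\neq\varnothing$; $\mathcal{B}_{\max}$ denotes its inclusion-maximal elements. An interval building set on $[n]$ is a building set all of whose elements are intervals $\{a,a+1,\dots,b\}$. A nested collection is a subset $N\subseteq\mathcal{B}\setminus\mathcal{B}_{\max}$ whose members are pairwise nested or disjoint and such that no union of $k\ge2$ pairwise disjoint members lies in $\mathcal{B}$; the nested complex $\mathcal{N}(\mathcal{B})$ is the simplicial complex on vertex set $\mathcal{B}\setminus\mathcal{B}_{\max}$ whose faces are the nested collections. An extended nested collection is a set $\{I_1,\dots,I_m,x_{i_1},\dots,x_{i_r}\}$ with $I_j\in\mathcal{B}$ (maximal elements allowed) and formal symbols $x_i$ ($i\in X$) such that the $I_j$ are pairwise nested or disjoint, no union of $k\ge2$ pairwise disjoint $I_j$'s lies in $\mathcal{B}$, and no $i_\ell$ lies in any $I_j$; the extended nested complex $\mathcal{N}^{\square}(\mathcal{B})$ is the simplicial complex on vertex set $\mathcal{B}\cup\{x_i:i\in X\}$ whose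 faces are the extended nested collections. *)

theory Defs
  imports Main "HOL-Library.Disjoint_Sets"
begin

record 'v complex =
  vertices :: "'v set"
  faces :: "'v set set"

definition simplicial_complex :: "'v complex \<Rightarrow> bool" where
  "simplicial_complex K \<longleftrightarrow>
     finite (vertices K) \<and> faces K \<subseteq> Pow (vertices K) \<and> {} \<in> faces K \<and>
     (\<forall>v \<in> vertices K. {v} \<in> faces K) \<and>
     (\<forall>\<sigma> \<in> faces K. \<forall>\<tau>. \<tau> \<subseteq> \<sigma> \<longrightarrow> \<tau> \<in> faces K)"

definition isomorphic_complexes :: "'v complex \<Rightarrow> 'w complex \<Rightarrow> bool" where
  "isomorphic_complexes K L \<longleftrightarrow>
     (\<exists>f. bij_betw f (vertices K) (vertices L) \<and>
          (\<forall>\<sigma>. \<sigma> \<subseteq> vertices K \<longrightarrow> (\<sigma> \<in> faces K \<longleftrightarrow> f ` \<sigma> \<in> faces L)))"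

definition building_set :: "'a set \<Rightarrow> 'a set set \<Rightarrow> bool" where
  "building_set X B \<longleftrightarrow>
     finite X \<and> (\<forall>I \<in> B. I \<noteq> {} \<and> I \<subseteq> X) \<and> (\<forall>x \<in> X. {x} \<in> B) \<and>
     (\<forall>I \<in> B. \<forall>J \<in> B. I \<inter> J \<noteq> {} \<longrightarrow> I \<union> J \<in> B)"

definition maximal_elements :: "'a set set \<Rightarrow> 'a set set" where
  "maximal_elements B = {I \<in> B. \<forall>J \<in> B. I \<subseteq> J \<longrightarrow> J = I}"

definition interval_building_set :: "nat \<Rightarrow> nat set set \<Rightarrow> bool" where
  "interval_building_set n B \<longleftrightarrow> building_set {1..n} B \<and> (\<forall>I \<in> B. \<exists>a b. I = {a..b})"

text \<open>The conditions shared by nested and extended nested collections. A union of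
  \<open>k \<ge> 2\<close> pairwise disjoint members is \<open>\<Union>S\<close> for a set \<open>S\<close> of \<open>k\<close> members; \<open>card S \<ge> 2\<close>
  forces \<open>S\<close> to be finite.\<close>

definition nested_in :: "'a set set \<Rightarrow> 'a set set \<Rightarrow> bool" where
  "nested_in B N \<longleftrightarrow>
     (\<forall>I \<in> N. \<forall>J \<in> N. I \<subseteq> J \<or> J \<subseteq> I \<or> I \<inter> J = {}) \<and>
     (\<forall>S. S \<subseteq> N \<and> card S \<ge> 2 \<and> disjoint S \<longrightarrow> \<Union>S \<notin> B)"

definition nested_collection :: "'a set set \<Rightarrow> 'a set set \<Rightarrow> bool" where
  "nested_collection B N \<longleftrightarrow> N \<subseteq> B - maximal_elements B \<and> nested_in B N"

definition nested_complex :: "'a set set \<Rightarrow> 'a set complex" where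
  "nested_complex B =
     \<lparr>vertices = B - maximal_elements B, faces = {N. nested_collection B N}\<rparr>"

text \<open>\<open>Symb i\<close> is the formal symbol $x_i$.\<close>

datatype 'a ext_vertex = Elem "'a set" | Symb 'a

definition ext_vertices :: "'a set \<Rightarrow> 'a set set \<Rightarrow> 'a ext_vertex set" where
  "ext_vertices X B = Elem ` B \<union> Symb ` X"

definition extended_nested_collection ::
  "'a set \<Rightarrow> 'a set set \<Rightarrow> 'a ext_vertex set \<Rightarrow> bool" where
  "extended_nested_collection X B \<sigma> \<longleftrightarrow>
     \<sigma> \<subseteq> ext_vertices X B \<and> nested_in B {I. Elem I \<in> \<sigma>} \<and>
     (\<forall>i I. Symb i \<in> \<sigma> \<and> Elem I \<in> \<sigma> \<longrightarrow> i \<notin> I)"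

definition extended_nested_complex :: "'a set \<Rightarrow> 'a set set \<Rightarrow> 'a ext_vertex complex" where
  "extended_nested_complex X B =
     \<lparr>vertices = ext_vertices X B, faces = {\<sigma>. extended_nested_collection X B \<sigma>}\<rparr>"

lemma finite_building_set:
  assumes "building_set X B"
  shows "finite B"
proof -
  have "B \<subseteq> Pow X" "finite X"
    using assms by (auto simp: building_set_def)
  then show ?thesis
    using finite_subset by blast
qed

lemma nested_in_mono:
  assumes "nested_in B N" "M \<subseteq> N"
  shows "nested_in B M"
  unfolding nested_in_def
proof (intro conjI ballI allI impI)
  fix I J assume "I \<in> M" "J \<in> M"
  then have "I \<in> N" "J \<in> N"
    using assms(2) by auto
  then show "I \<subseteq> J \<or> J \<subseteq> I \<or> I \<inter> J = {}"
    using assms(1) by (simp add: nested_in_def)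
next
  fix S assume S: "S \<subseteq> M \<and> 2 \<le> card S \<and> disjoint S"
  then have "S \<subseteq> N"
    using assms(2) by auto
  then show "\<Union>S \<notin> B"
    using S assms(1) by (simp add: nested_in_def)
qed

lemma nested_in_le_1:
  assumes "N \<subseteq> {I}"
  shows "nested_in B N"
  unfolding nested_in_def
proof (intro conjI ballI allI impI)
  fix J K assume "J \<in> N" "K \<in> N"
  then have "J = I" "K = I"
    using assms by auto
  then show "J \<subseteq> K \<or> K \<subseteq> J \<or> J \<inter> K = {}"
    by simp
next
  fix S assume S: "S \<subseteq> N \<and> 2 \<le> card S \<and> disjoint S"
  then have "S \<subseteq> {I}"
    using assms by auto
  then have "card S \<le> 1"
    using card_mono[of "{I}" S] by simp
  then show "\<Union>S \<notin> B"
    using S by linarith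
qed

lemma simplicial_complex_nested_complex:
  assumes "building_set X B"
  shows "simplicial_complex (nested_complex B)"
proof -
  have mono: "nested_collection B M" if "nested_collection B N" "M \<subseteq> N" for M N
    unfolding nested_collection_def
  proof
    show "M \<subseteq> B - maximal_elements B"
      using that unfolding nested_collection_def by (meson subset_trans)
    show "nested_in B M"
      using that nested_in_mono[of B N M] by (simp add: nested_collection_def)
  qed
  have single: "nested_collection B {I}" if "I \<in> B - maximal_elements B" for I
    using that nested_in_le_1[of "{I}" I] by (simp add: nested_collection_def)
  show ?thesis
    unfolding simplicial_complex_def
  proof (intro conjI ballI allI impI)
    show "finite (vertices (nested_complex B))"
      using finite_building_set[OF assms] by (simp add: nested_complex_def)
    show "faces (nested_complex B) \<subseteq> Pow (vertices (nested_complex B))"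
      by (simp add: nested_complex_def nested_collection_def Collect_mono_iff Pow_def)
    show "{} \<in> faces (nested_complex B)"
      using nested_in_le_1[of "{}"] by (simp add: nested_complex_def nested_collection_def)
    show "{I} \<in> faces (nested_complex B)" if "I \<in> vertices (nested_complex B)" for I
      using that single by (simp add: nested_complex_def)
    show "M \<in> faces (nested_complex B)" if "N \<in> faces (nested_complex B)" "M \<subseteq> N" for M N
      using that mono[of N M] by (simp add: nested_complex_def)
  qed
qed

lemma simplicial_complex_extended_nested_complex:
  assumes "building_set X B"
  shows "simplicial_complex (extended_nested_complex X B)"
proof -
  have mono: "extended_nested_collection X B \<tau>"
    if "extended_nested_collection X B \<sigma>" "\<tau> \<subseteq> \<sigma>" for \<sigma> \<tau>
    unfolding extended_nested_collection_def
  proof (intro conjI allI impI)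
    show "\<tau> \<subseteq> ext_vertices X B"
      using that unfolding extended_nested_collection_def by (meson subset_trans)
    have "{I. Elem I \<in> \<tau>} \<subseteq> {I. Elem I \<in> \<sigma>}"
      using that(2) by blast
    moreover have "nested_in B {I. Elem I \<in> \<sigma>}"
      using that(1) by (simp add: extended_nested_collection_def)
    ultimately show "nested_in B {I. Elem I \<in> \<tau>}"
      using nested_in_mono by blast
    fix i I assume "Symb i \<in> \<tau> \<and> Elem I \<in> \<tau>"
    then have "Symb i \<in> \<sigma> \<and> Elem I \<in> \<sigma>"
      using that(2) by blast
    then show "i \<notin> I"
      using that(1) by (simp add: extended_nested_collection_def)
  qed
  have single: "extended_nested_collection X B {v}" if v: "v \<in> ext_vertices X B" for v
  proof (cases v)
    case (Elem I)
    then show ?thesis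
      using v nested_in_le_1[of "{I}" I] by (simp add: extended_nested_collection_def)
  next
    case (Symb i)
    then show ?thesis
      using v nested_in_le_1[of "{}"] by (simp add: extended_nested_collection_def)
  qed
  show ?thesis
    unfolding simplicial_complex_def
  proof (intro conjI ballI allI impI)
    show "finite (vertices (extended_nested_complex X B))"
      using assms finite_building_set[OF assms]
      by (simp add: extended_nested_complex_def ext_vertices_def building_set_def)
    show "faces (extended_nested_complex X B) \<subseteq> Pow (vertices (extended_nested_complex X B))"
      by (simp add: extended_nested_complex_def extended_nested_collection_def
          Collect_mono_iff Pow_def)
    show "{} \<in> faces (extended_nested_complex X B)"
      using nested_in_le_1[of "{}"]
      by (simp add: extended_nested_complex_def extended_nested_collection_def)
    show "{v} \<in> faces (extended_nested_complex X B)"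
      if "v \<in> vertices (extended_nested_complex X B)" for v
      using that single by (simp add: extended_nested_complex_def)
    show "\<tau> \<in> faces (extended_nested_complex X B)"
      if "\<sigma> \<in> faces (extended_nested_complex X B)" "\<tau> \<subseteq> \<sigma>" for \<sigma> \<tau>
      using that mono[of \<sigma> \<tau>] by (simp add: extended_nested_complex_def)
  qed
qed

end

theory Submission
  imports Defs
begin

text \<open>The isomorphism fixes \<open>\<B>\<close> and sends the symbol $x_i$ to the final segment \<open>{i+1..n+1}\<close>;
  the final segment \<open>{1..n+1}\<close> is the only maximal element of \<open>\<B>'\<close>. Final segments are pairwise
  nested, and an interval \<open>I \<in> \<B>\<close> fails to be compatible with \<open>{i+1..n+1}\<close> exactly when
  \<open>i \<in> I\<close>: either \<open>I\<close> crosses the left end of the segment or it ends at \<open>i\<close>, and then the disjoint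
  union is again a final segment. Conversely, if the union of a final segment \<open>{i+1..n+1}\<close> and
  further disjoint sets of \<open>\<B>\<close> is a final segment, then one of these sets contains \<open>i\<close>.\<close>

definition final_segments :: "nat \<Rightarrow> nat set set" where
  "final_segments n = {{i..n + 1} | i. 1 \<le> i \<and> i \<le> n + 1}"

primrec vertex_map :: "nat \<Rightarrow> nat ext_vertex \<Rightarrow> nat set" where
  "vertex_map n (Elem I) = I"
| "vertex_map n (Symb i) = {i + 1..n + 1}"

section \<open>Final segments of the integer interval\<close>

lemma final_segmentsI: "1 \<le> i \<Longrightarrow> i \<le> n + 1 \<Longrightarrow> {i..n + 1} \<in> final_segments n"
  by (auto simp: final_segments_def)

lemma final_segmentsE:
  assumes "J \<in> final_segments n"
  obtains i where "1 \<le> i" "i \<le> n + 1" "J = {i..n + 1}"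
  using assms by (auto simp: final_segments_def)

text \<open>The bound \<open>i \<le> b + 1\<close> admits adjacent as well as overlapping intervals:
  overlap is what closure under unions needs, adjacency is what makes \<open>{a..i}\<close> and
  \<open>{i + 1..m}\<close> incompatible.\<close>

lemma atLeastAtMost_Un_final_segment:
  fixes a b i m :: nat
  assumes "a \<le> b" "b \<le> m" "i \<le> b + 1" "i \<le> m"
  shows "{a..b} \<union> {i..m} = {min a i..m}"
  using assms by auto

locale interval_building =
  fixes n :: nat and B :: "nat set set"
  assumes B: "interval_building_set n B"
begin

abbreviation B' :: "nat set set" where
  "B' \<equiv> B \<union> final_segments n"

section \<open>The extended family as a building set\<close>

lemma building: "building_set {1..n} B"
  using B by (simp add: interval_building_set_def)

lemma elem_interval:
  assumes "I \<in> B"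
  obtains a b where "I = {a..b}" "1 \<le> a" "a \<le> b" "b \<le> n"
proof -
  obtain a b where I: "I = {a..b}"
    using B assms unfolding interval_building_set_def by blast
  moreover have "I \<noteq> {}" "I \<subseteq> {1..n}"
    using building assms by (auto simp: building_set_def)
  ultimately show ?thesis
    using that by auto
qed

lemma elem_nonempty: "I \<in> B \<Longrightarrow> I \<noteq> {}"
  and elem_subset: "I \<in> B \<Longrightarrow> I \<subseteq> {1..n}"
  using building by (auto simp: building_set_def)

text \<open>The point \<open>n + 1\<close> serves as a marker: it lies in every final segment, so it
  separates these from the members of \<open>B\<close>.\<close>

lemma Suc_notin_elem: "I \<in> B \<Longrightarrow> Suc n \<notin> I"
  using elem_subset by fastforce

lemma Un_final_segment:
  assumes I: "I \<in> B" and J: "J \<in> final_segments n" and IJ: "I \<inter> J \<noteq> {}"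
  shows "I \<union> J \<in> final_segments n"
proof -
  obtain a b where ab: "I = {a..b}" "1 \<le> a" "a \<le> b" "b \<le> n"
    using I by (rule elem_interval)
  obtain i where i: "1 \<le> i" "i \<le> n + 1" "J = {i..n + 1}"
    using J by (rule final_segmentsE)
  have "I \<union> J = {min a i..n + 1}"
    using ab i IJ atLeastAtMost_Un_final_segment[of a b "n + 1" i] by auto
  then show ?thesis
    using ab i final_segmentsI[of "min a i" n] by simp
qed

lemma building_set_extension: "building_set {1..n + 1} B'"
  unfolding building_set_def
proof (intro conjI ballI impI)
  show "finite {1..n + 1}"
    by simp
  show "I \<noteq> {}" "I \<subseteq> {1..n + 1}" if "I \<in> B'" for I
    using that elem_nonempty elem_subset by (fastforce simp: final_segments_def)+
  show "{x} \<in> B'" if "x \<in> {1..n + 1}" for x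
  proof (cases "x = n + 1")
    case True
    then show ?thesis
      using final_segmentsI[of "n + 1" n] by simp
  next
    case False
    then show ?thesis
      using that building by (simp add: building_set_def)
  qed
  fix I J assume IJ: "I \<in> B'" "J \<in> B'" "I \<inter> J \<noteq> {}"
  have "I \<union> J \<in> B" if "I \<in> B" "J \<in> B"
    using that IJ building by (simp add: building_set_def)
  moreover have "I \<union> J \<in> final_segments n" if "I \<in> final_segments n" "J \<in> final_segments n"
  proof -
    have "I \<subseteq> J \<or> J \<subseteq> I"
      using that by (auto simp: final_segments_def)
    then show ?thesis
      using that by (auto simp: Un_absorb1 Un_absorb2)
  qed
  moreover have "I \<union> J \<in> final_segments n" if "I \<in> B" "J \<in> final_segments n"
    using that IJ Un_final_segment by blast
  moreover have "I \<union> J \<in> final_segments n" if "I \<in> final_segments n" "J \<in> B"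
    using that IJ Un_final_segment[of J I] by (simp add: Un_commute Int_commute)
  ultimately show "I \<union> J \<in> B'"
    using IJ by blast
qed

section \<open>The bijection on vertices\<close>

lemma maximal_elements_extension: "maximal_elements B' = {{1..n + 1}}"
proof -
  have "{1..n + 1} \<in> B'"
    using final_segmentsI[of 1 n] by simp
  moreover have "J \<subseteq> {1..n + 1}" if "J \<in> B'" for J
    using that building_set_extension by (simp add: building_set_def)
  ultimately show ?thesis
    unfolding maximal_elements_def by blast
qed

text \<open>The shift from \<open>i\<close> to \<open>i + 1\<close> makes the segments start at 2,
  \<dots>, \<open>n + 1\<close>. Exactly \<open>{1..n + 1}\<close> is left out, which is the one
  maximal element.\<close>

lemma bij_betw_vertex_map:
  "bij_betw (vertex_map n) (ext_vertices {1..n} B) (B' - maximal_elements B')"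
  unfolding bij_betw_def
proof
  show "inj_on (vertex_map n) (ext_vertices {1..n} B)"
  proof (rule inj_onI)
    fix u v assume u: "u \<in> ext_vertices {1..n} B" and v: "v \<in> ext_vertices {1..n} B"
      and eq: "vertex_map n u = vertex_map n v"
    \<comment> \<open>The marker \<open>n + 1\<close> shows that an element and a symbol never share
      an image. Two symbols are told apart by the left ends of their segments, which are
      nonempty.\<close>
    have "Suc n \<in> vertex_map n w \<longleftrightarrow> w \<in> Symb ` {1..n}" if "w \<in> ext_vertices {1..n} B" for w
      using that Suc_notin_elem by (auto simp: ext_vertices_def)
    then show "u = v"
      using u v eq by (auto simp: ext_vertices_def Icc_eq_Icc)
  qed
  have "vertex_map n ` ext_vertices {1..n} B = B \<union> {{i + 1..n + 1} | i. i \<in> {1..n}}"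
    by (auto simp: ext_vertices_def image_Un image_image)
  also have "{{i + 1..n + 1} | i. i \<in> {1..n}} = final_segments n - {{1..n + 1}}" (is "?L = ?R")
  proof
    show "?L \<subseteq> ?R"
      by (auto simp: final_segments_def Icc_eq_Icc)
    show "?R \<subseteq> ?L"
    proof
      fix J assume J: "J \<in> ?R"
      then obtain i where i: "1 \<le> i" "i \<le> n + 1" "J = {i..n + 1}"
        by (auto elim: final_segmentsE)
      with J have "i \<noteq> 1"
        by auto
      with i have "J = {(i - 1) + 1..n + 1}" "i - 1 \<in> {1..n}"
        by auto
      then show "J \<in> ?L"
        by blast
    qed
  qed
  also have "B \<union> (final_segments n - {{1..n + 1}}) = B' - maximal_elements B'"
    using Suc_notin_elem[of "{1..n + 1}"] by (auto simp: maximal_elements_extension)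
  finally show "vertex_map n ` ext_vertices {1..n} B = B' - maximal_elements B'" .
qed

section \<open>Compatibility of intervals and final segments\<close>

lemma incompatible_final_segment:
  assumes N: "nested_in B' N" and I: "I \<in> B" "I \<in> N" and i: "i \<in> I" "{i + 1..n + 1} \<in> N"
  shows False
proof -
  obtain a b where ab: "I = {a..b}" "1 \<le> a" "a \<le> b" "b \<le> n"
    using I(1) by (rule elem_interval)
  let ?J = "{i + 1..n + 1}"
  have "I \<subseteq> ?J \<or> ?J \<subseteq> I \<or> I \<inter> ?J = {}"
    using N I i by (simp add: nested_in_def)
  \<comment> \<open>The point \<open>i\<close> lies in \<open>I\<close> only, and
    \<open>n + 1\<close> lies in \<open>?J\<close> only.\<close>
  moreover have "\<not> I \<subseteq> ?J" "\<not> ?J \<subseteq> I"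
    using i ab by auto
  ultimately have disj: "I \<inter> ?J = {}"
    by blast
  have "b = i"
  proof (rule ccontr)
    assume "b \<noteq> i"
    then have "i + 1 \<in> I \<inter> ?J"
      using i ab by auto
    then show False
      using disj by blast
  qed
  then have "\<Union>{I, ?J} = {a..n + 1}"
    using ab atLeastAtMost_Un_final_segment[of a b "n + 1" "i + 1"] by simp
  then have "\<Union>{I, ?J} \<in> B'"
    using ab final_segmentsI[of a n] by simp
  moreover have "card {I, ?J} \<ge> 2"
    using \<open>\<not> I \<subseteq> ?J\<close> by (cases "I = ?J") auto
  moreover have "disjoint {I, ?J}"
    using disj by (auto simp: disjoint_def)
  moreover have "{I, ?J} \<subseteq> N"
    using I i by simp
  ultimately show False
    using N unfolding nested_in_def by blast
qed

text \<open>If \<open>S\<close> has no final segment, its union misses \<open>n + 1\<close> and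
  could only lie in \<open>B\<close>, which nestedness of \<open>N\<close> excludes. Otherwise the
  union contains \<open>n + 1\<close>, so it could only be a final segment, and this would force a
  member of \<open>N\<close> to contain \<open>i\<close>.\<close>

lemma disjoint_Union_notin_extension:
  assumes N: "nested_in B N" "N \<subseteq> B"
    and compat: "\<And>i I. i \<in> A \<Longrightarrow> I \<in> N \<Longrightarrow> i \<notin> I"
    and S: "S \<subseteq> N \<union> (\<lambda>i. {i + 1..n + 1}) ` A" "card S \<ge> 2" "disjoint S"
    and A: "A \<subseteq> {1..n}"
  shows "\<Union>S \<notin> B'"
proof (cases "S \<subseteq> N")
  case True
  then have "\<Union>S \<notin> B"
    using N S by (simp add: nested_in_def)
  moreover have "Suc n \<notin> \<Union>S"
    using True N Suc_notin_elem by blast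
  then have "\<Union>S \<notin> final_segments n"
    by (auto elim!: final_segmentsE)
  ultimately show ?thesis
    by simp
next
  case False
  then obtain i where i: "i \<in> A" "{i + 1..n + 1} \<in> S"
    using S(1) by blast
  let ?J = "{i + 1..n + 1}"
  have i_le: "i \<le> n"
    using i A by auto
  \<comment> \<open>All segments share the point \<open>n + 1\<close>, so a disjoint family contains
    at most one of them.\<close>
  have others: "I \<in> N \<and> I \<inter> ?J = {}" if I: "I \<in> S" "I \<noteq> ?J" for I
  proof -
    have disj: "I \<inter> ?J = {}"
      using S(3) i I by (auto simp: disjoint_def)
    have "Suc n \<in> ?J"
      using i_le by simp
    with disj have "Suc n \<notin> I"
      by blast
    moreover have "Suc n \<in> {k + 1..n + 1}" if "k \<in> A" for k
      using that A by auto
    ultimately show ?thesis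
      using disj S(1) I(1) by blast
  qed
  show ?thesis
  proof
    assume US: "\<Union>S \<in> B'"
    have "Suc n \<in> \<Union>S"
      using i i_le by (intro UnionI[of ?J]) auto
    with US have "\<Union>S \<in> final_segments n"
      using Suc_notin_elem by blast
    then obtain j where j: "\<Union>S = {j..n + 1}"
      by (rule final_segmentsE)
    have "\<not> S \<subseteq> {?J}"
      using S(2) card_mono[of "{?J}" S] by auto
    then obtain I where I: "I \<in> S" "I \<noteq> ?J"
      by blast
    then obtain x where x: "x \<in> I"
      using others N(2) elem_nonempty by blast
    \<comment> \<open>A point \<open>x\<close> of a second member satisfies
      \<open>j \<le> x \<le> i\<close>, so a union without gaps must also cover
      \<open>i\<close>.\<close>
    have "x \<in> {j..n + 1}"
      using j x I by blast
    moreover have "x \<notin> ?J"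
      using x I others by blast
    ultimately have "i \<in> {j..n + 1}"
      using i_le by auto
    then obtain K where K: "K \<in> S" "i \<in> K"
      using j by blast
    then have "K \<noteq> ?J"
      by auto
    then show False
      using K others compat i(1) by blast
  qed
qed

lemma nested_in_extension:
  assumes N: "nested_in B N" "N \<subseteq> B"
    and compat: "\<And>i I. i \<in> A \<Longrightarrow> I \<in> N \<Longrightarrow> i \<notin> I"
    and A: "A \<subseteq> {1..n}"
  shows "nested_in B' (N \<union> (\<lambda>i. {i + 1..n + 1}) ` A)"
  unfolding nested_in_def
proof (intro conjI ballI allI impI)
  let ?seg = "\<lambda>i. {i + 1..n + 1}"
  \<comment> \<open>An interval that misses \<open>i\<close> lies either wholly to its right, hence
    inside the segment, or wholly to its left, hence disjoint from it.\<close>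
  have mixed: "I \<subseteq> ?seg i \<or> I \<inter> ?seg i = {}" if I: "I \<in> N" and i: "i \<in> A" for I i
  proof -
    obtain a b where ab: "I = {a..b}" "b \<le> n"
      using I N(2) elem_interval by (metis subsetD)
    show ?thesis
      using compat[OF i I] ab by (cases "i < a") auto
  qed
  fix I J assume "I \<in> N \<union> ?seg ` A" "J \<in> N \<union> ?seg ` A"
  moreover have "I \<subseteq> J \<or> J \<subseteq> I \<or> I \<inter> J = {}" if "I \<in> N" "J \<in> N"
    using that N(1) by (simp add: nested_in_def)
  moreover have "I \<subseteq> J \<or> J \<subseteq> I" if "I \<in> ?seg ` A" "J \<in> ?seg ` A"
    using that by auto
  ultimately show "I \<subseteq> J \<or> J \<subseteq> I \<or> I \<inter> J = {}"
    using mixed by blast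
next
  fix S
  assume "S \<subseteq> N \<union> (\<lambda>i. {i + 1..n + 1}) ` A \<and> 2 \<le> card S \<and> disjoint S"
  then show "\<Union>S \<notin> B'"
    using disjoint_Union_notin_extension[OF N compat _ _ _ A] by blast
qed

section \<open>Correspondence of faces\<close>

lemma extended_nested_collection_iff:
  assumes \<sigma>: "\<sigma> \<subseteq> ext_vertices {1..n} B"
  shows "extended_nested_collection {1..n} B \<sigma> \<longleftrightarrow> nested_collection B' (vertex_map n ` \<sigma>)"
proof -
  define N where "N = {I. Elem I \<in> \<sigma>}"
  define A where "A = {i. Symb i \<in> \<sigma>}"
  have N: "N \<subseteq> B" and A: "A \<subseteq> {1..n}"
    using \<sigma> by (auto simp: N_def A_def ext_vertices_def)
  have "\<sigma> = Elem ` N \<union> Symb ` A"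
    unfolding N_def A_def by (auto simp: image_iff) (metis ext_vertex.exhaust)
  then have img: "vertex_map n ` \<sigma> = N \<union> (\<lambda>i. {i + 1..n + 1}) ` A"
    by (simp add: image_Un image_image)
  \<comment> \<open>The bijection already places the image among the vertices, so only the
    \<open>nested_in\<close> condition remains to be compared.\<close>
  have "vertex_map n ` \<sigma> \<subseteq> B' - maximal_elements B'"
    using image_mono[OF \<sigma>, of "vertex_map n"] bij_betw_imp_surj_on[OF bij_betw_vertex_map]
    by simp
  then have rhs: "nested_collection B' (vertex_map n ` \<sigma>) \<longleftrightarrow>
      nested_in B' (N \<union> (\<lambda>i. {i + 1..n + 1}) ` A)"
    unfolding nested_collection_def img by simp
  have lhs: "extended_nested_collection {1..n} B \<sigma> \<longleftrightarrow>
      nested_in B N \<and> (\<forall>i \<in> A. \<forall>I \<in> N. i \<notin> I)"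
    using \<sigma> by (auto simp: extended_nested_collection_def N_def A_def)
  show ?thesis
    unfolding lhs rhs
  proof (intro iffI conjI ballI)
    assume "nested_in B N \<and> (\<forall>i \<in> A. \<forall>I \<in> N. i \<notin> I)"
    then show "nested_in B' (N \<union> (\<lambda>i. {i + 1..n + 1}) ` A)"
      using nested_in_extension[OF _ N _ A] by simp
  next
    assume nested: "nested_in B' (N \<union> (\<lambda>i. {i + 1..n + 1}) ` A)"
    then have "nested_in B' N"
      by (rule nested_in_mono) simp
    \<comment> \<open>Since \<open>B\<close> is contained in \<open>B'\<close>, a union outside
      \<open>B'\<close> is also outside \<open>B\<close>.\<close>
    then show "nested_in B N"
      by (simp add: nested_in_def)
    show "i \<notin> I" if "i \<in> A" "I \<in> N" for i I
    proof
      assume "i \<in> I"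
      moreover have "I \<in> B"
        using that N by blast
      ultimately show False
        using incompatible_final_segment[OF nested, of I i] that by auto
    qed
  qed
qed

end

theorem theorem4p10:
  fixes n :: nat and B B' :: "nat set set"
  assumes "interval_building_set n B"
    and "B' = B \<union> {{i..n + 1} | i. 1 \<le> i \<and> i \<le> n + 1}"
  shows "building_set {1..n + 1} B' \<and>
    isomorphic_complexes (extended_nested_complex {1..n} B) (nested_complex B')"
proof -
  interpret interval_building n B
    using assms(1) by unfold_locales
  have B': "B' = B \<union> final_segments n"
    using assms(2) by (simp add: final_segments_def)
  have "isomorphic_complexes (extended_nested_complex {1..n} B) (nested_complex B')"
    unfolding isomorphic_complexes_def B' extended_nested_complex_def nested_complex_def
    using bij_betw_vertex_map extended_nested_collection_iff
    by (intro exI[of _ "vertex_map n"]) simp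
  then show ?thesis
    using building_set_extension B' by simp
qed

end
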